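(* Let $X$ be a metric space, and let $\mu$ be an Ahlfors $s$-regular measure on $X$ for some $s\in(0,\infty)$. Let $0\le r\le 1$ and $0<q<\infty$ be such that $rq\le s$. Let $(Y,\rho)$ be a metric space and let $u\in B^r_{q,\infty}(X,\mu;Y)$. Then there exists a set $D\subset X$ which is $\sigma$-finite with respect to the Hausdorff measure $\mathcal H^{s-rq}$ such that every point $x\in X\setminus D$ is a general average Lebesgue point of $u$, i.e. $$\liminf_{\varepsilon\to0^+}\frac{1}{\mu(B_\varepsilon(x))^2}\int_{B_\varepsilon(x)}\int_{B_\varepsilon(x)}\rho(u(z),u(v))^q\,d\mu(v)\,d\mu(z)=0 .$$
   Context: $B_t(x)$ denotes the closed ball with center $x$ and radius $t\in(0,\infty)$. A Borel measure on $X$ is a positive outer measure for which all Borel sets are measurable. $\frac{1}{\mu(B)}\int_B f\,d\mu$ is also written ⨍$_B f\,d\mu$ (average integral). Ahlfors $s$-regular: a Borel measure $\mu$ on $X$ for which there are constants $c,C>0$ with $c\,t^s\le\mu(B_t(x))\le C\,t^s$ for all $x\in X$ and all $0<t<\operatorname{diam}(X)$. Local integrability: $F\in L^q_{\mathrm{loc}}(X\times X,\mu\times\mu)$ means $F$ is $\mu\times\mu$-measurable and $\int_B|F|^q\,d(\mu\times\mu)<\infty$ for every closed ball $B\subset X\times X$. Besov space: assume $0<\mu(B)<\infty$ for every closed ball $B\subset X$. A $\mu$-measurable function $u:X\to Y$ belongs to $B^r_{q,\infty}(X,\mu;Y)$ iff $F_u(x,z):=\rho(u(x),u(z))$ belongs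 to $L^q_{\mathrm{loc}}(X\times X,\mu\times\mu)$ and $$\|u\|_{B^r_{q,\infty}(X,\mu;Y)}:=\sup_{t>0}\left(\int_X\frac1{\mu(B_t(x))}\int_{B_t(x)}\frac{\rho(u(x),u(z))^q}{t^{rq}}\,d\mu(z)\,d\mu(x)\right)^{1/q}<\infty.$$ Hausdorff measure: for $\alpha\in[0,\infty)$, $\mathcal H^\alpha(E)=\lim_{\delta\to0^+}\mathcal H^\alpha_\delta(E)$ with $\mathcal H^\alpha_\delta(E)=\inf\{\sum_{i=1}^\infty(\operatorname{diam}E_i)^\alpha: E\subset\bigcup_iE_i,\ \operatorname{diam}(E_i)\le\delta\}$ (with the usual convention that $\mathcal H^0$ is counting measure). A set is $\sigma$-finite with respect to $\mathcal H^\alpha$ if it is a countable union of sets of finite $\mathcal H^\alpha$ measure. *)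

theory Defs
  imports "HOL-Analysis.Analysis"
begin

text \<open>
  A measure is an outer measure defined on all subsets; measurability means measurability in the
  sense of Caratheodory, i.e. membership in \<^const>\<open>lambda_system\<close>. The library predicate
  \<^const>\<open>countably_subadditive\<close> speaks of disjoint families only; together with monotonicity on
  all subsets this is the usual countable subadditivity.
\<close>

definition caratheodory_sets :: "('a set \<Rightarrow> ennreal) \<Rightarrow> 'a set set" where
  "caratheodory_sets \<mu> = lambda_system UNIV UNIV \<mu>"

definition borel_outer_measure :: "('a::topological_space set \<Rightarrow> ennreal) \<Rightarrow> bool" where
  "borel_outer_measure \<mu> \<longleftrightarrow>
     outer_measure_space UNIV \<mu> \<and> sets borel \<subseteq> caratheodory_sets \<mu>"

definition caratheodory_measure :: "('a set \<Rightarrow> ennreal) \<Rightarrow> 'a measure" where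
  "caratheodory_measure \<mu> = measure_of UNIV (caratheodory_sets \<mu>) \<mu>"

lemma measure_space_caratheodory:
  assumes "outer_measure_space UNIV \<mu>"
  shows "measure_space UNIV (caratheodory_sets \<mu>) \<mu>"
  using sigma_algebra.caratheodory_lemma[OF sigma_algebra_Pow[of UNIV], of \<mu>] assms
  by (simp add: caratheodory_sets_def)

lemma space_caratheodory_measure [simp]: "space (caratheodory_measure \<mu>) = UNIV"
  by (simp add: caratheodory_measure_def)

lemma sets_caratheodory_measure:
  assumes "outer_measure_space UNIV \<mu>"
  shows "sets (caratheodory_measure \<mu>) = caratheodory_sets \<mu>"
proof -
  have "sigma_algebra UNIV (caratheodory_sets \<mu>)"
    using measure_space_caratheodory[OF assms] by (simp add: measure_space_def)
  then show ?thesis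
    by (simp add: caratheodory_measure_def sets_measure_of_conv sigma_algebra.sigma_sets_eq)
qed

lemma emeasure_caratheodory_measure:
  assumes "outer_measure_space UNIV \<mu>" "A \<in> caratheodory_sets \<mu>"
  shows "emeasure (caratheodory_measure \<mu>) A = \<mu> A"
proof -
  note ms = measure_space_caratheodory[OF assms(1)]
  then have "sigma_algebra UNIV (caratheodory_sets \<mu>)" by (simp add: measure_space_def)
  then show ?thesis
    using ms assms(2) unfolding caratheodory_measure_def
    by (intro emeasure_measure_of_sigma) (auto simp: measure_space_def)
qed

text \<open>
  The library's \<^const>\<open>diameter\<close> is real-valued and meaningless for unbounded sets, so an
  extended diameter is used, with value \<open>\<infinity>\<close> on unbounded sets and \<open>0\<close> on the empty set.
\<close>

definition ediam :: "'a::metric_space set \<Rightarrow> ennreal" where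
  "ediam E = (SUP (x, y) \<in> E \<times> E. ennreal (dist x y))"

definition ahlfors_regular :: "real \<Rightarrow> ('a::metric_space set \<Rightarrow> ennreal) \<Rightarrow> bool" where
  "ahlfors_regular s \<mu> \<longleftrightarrow> borel_outer_measure \<mu> \<and>
     (\<exists>c C::real. 0 < c \<and> 0 < C \<and>
       (\<forall>x t. 0 < t \<and> ennreal t < ediam (UNIV :: 'a set) \<longrightarrow>
          ennreal (c * t powr s) \<le> \<mu> (cball x t) \<and> \<mu> (cball x t) \<le> ennreal (C * t powr s)))"

text \<open>
  Real powers with nonnegative exponent on \<open>[0, \<infinity>]\<close>. Unlike \<open>powr\<close> (for which
  \<open>0 powr 0 = 0\<close>), the convention here is \<open>x ^ 0 = 1\<close> for all \<open>x\<close>.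
\<close>

definition ennreal_rpow :: "ennreal \<Rightarrow> real \<Rightarrow> ennreal" where
  "ennreal_rpow x a =
     (if a = 0 then 1 else if x = \<infinity> then \<infinity> else ennreal (enn2real x powr a))"

definition besov_norm ::
  "('a::metric_space set \<Rightarrow> ennreal) \<Rightarrow> real \<Rightarrow> real \<Rightarrow> ('a \<Rightarrow> 'b::metric_space) \<Rightarrow> ennreal" where
  "besov_norm \<mu> r q u =
     (SUP t\<in>{0::real<..}.
        ennreal_rpow
          (\<integral>\<^sup>+x. (1 / \<mu> (cball x t)) *
             (\<integral>\<^sup>+z\<in>cball x t. ennreal (dist (u x) (u z) powr q / t powr (r * q))
                \<partial>caratheodory_measure \<mu>)
             \<partial>caratheodory_measure \<mu>)
          (1 / q))"

text \<open>
  Caratheodory measurability for the product outer measure \<open>\<mu> \<times> \<mu>\<close> of a \<open>\<sigma>\<close>-finite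
  \<open>\<mu>\<close> is measurability for the completed product measure. \<open>\<sigma>\<close>-finiteness holds wherever this
  is used below, since balls are assumed to have finite measure. Closed balls
  in \<open>'a \<times> 'a\<close> refer to the library's Euclidean product distance; any of the
  usual product distances gives the same condition.
\<close>

definition Lq_loc_prod ::
  "real \<Rightarrow> ('a::metric_space set \<Rightarrow> ennreal) \<Rightarrow> ('a \<times> 'a \<Rightarrow> real) \<Rightarrow> bool" where
  "Lq_loc_prod q \<mu> F \<longleftrightarrow>
     (let P = completion (caratheodory_measure \<mu> \<Otimes>\<^sub>M caratheodory_measure \<mu>) in
        F \<in> borel_measurable P \<and>
        (\<forall>p R. 0 < R \<longrightarrow> (\<integral>\<^sup>+w\<in>cball p R. ennreal (\<bar>F w\<bar> powr q) \<partial>P) < \<infinity>))"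

text \<open>
  The first conjunct is the standing assumption under which the Besov space is defined at all.
  It does not follow from Ahlfors regularity, which only controls radii
  below the diameter of the space.
\<close>

definition besov_space ::
  "('a::metric_space set \<Rightarrow> ennreal) \<Rightarrow> real \<Rightarrow> real \<Rightarrow> ('a \<Rightarrow> 'b::metric_space) set" where
  "besov_space \<mu> r q =
     {u. (\<forall>x t. 0 < t \<longrightarrow> 0 < \<mu> (cball x t) \<and> \<mu> (cball x t) < \<infinity>) \<and>
         u \<in> borel_measurable (caratheodory_measure \<mu>) \<and>
         Lq_loc_prod q \<mu> (\<lambda>(x, z). dist (u x) (u z)) \<and>
         besov_norm \<mu> r q u < \<infinity>}"

text \<open>
  Separating out the empty set makes the \<open>0\<close>-dimensional measure the counting measure:
  \<open>diam E ^ 0\<close> is \<open>1\<close> for nonempty \<open>E\<close>, and \<open>0\<close> for empty \<open>E\<close>.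
\<close>

definition hausdorff_gauge :: "real \<Rightarrow> 'a::metric_space set \<Rightarrow> ennreal" where
  "hausdorff_gauge \<alpha> E = (if E = {} then 0 else ennreal_rpow (ediam E) \<alpha>)"

definition hausdorff_content :: "real \<Rightarrow> real \<Rightarrow> 'a::metric_space set \<Rightarrow> ennreal" where
  "hausdorff_content \<alpha> \<delta> E =
     (INF A \<in> {A :: nat \<Rightarrow> 'a set. E \<subseteq> (\<Union>i. A i) \<and> (\<forall>i. ediam (A i) \<le> ennreal \<delta>)}.
        (\<Sum>i. hausdorff_gauge \<alpha> (A i)))"

definition hausdorff_measure :: "real \<Rightarrow> 'a::metric_space set \<Rightarrow> ennreal" where
  "hausdorff_measure \<alpha> E = Lim (at_right 0) (\<lambda>\<delta>. hausdorff_content \<alpha> \<delta> E)"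

lemma hausdorff_content_antimono:
  assumes "\<delta> \<le> \<delta>'"
  shows "hausdorff_content \<alpha> \<delta>' E \<le> hausdorff_content \<alpha> \<delta> E"
  unfolding hausdorff_content_def
  by (rule INF_superset_mono) (use assms in \<open>auto intro: order_trans ennreal_leI\<close>)

lemma hausdorff_content_tendsto:
  "((\<lambda>\<delta>. hausdorff_content \<alpha> \<delta> E) \<longlongrightarrow>
      (SUP \<delta>\<in>{0<..}. hausdorff_content \<alpha> \<delta> E)) (at_right 0)"
proof (rule increasing_tendsto)
  show "\<forall>\<^sub>F \<delta> in at_right 0.
      hausdorff_content \<alpha> \<delta> E \<le> (SUP \<delta>\<in>{0<..}. hausdorff_content \<alpha> \<delta> E)"
    by (auto simp: eventually_at_filter intro!: SUP_upper always_eventually)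
next
  fix y assume "y < (SUP \<delta>\<in>{0<..}. hausdorff_content \<alpha> \<delta> E)"
  then obtain d where d: "0 < d" "y < hausdorff_content \<alpha> d E"
    by (auto simp: less_SUP_iff)
  then have "\<forall>\<^sub>F \<delta> in at_right (0::real). \<delta> < d"
    by (auto simp: eventually_at_right_field)
  then show "\<forall>\<^sub>F \<delta> in at_right 0. y < hausdorff_content \<alpha> \<delta> E"
    by eventually_elim (use d in \<open>meson hausdorff_content_antimono less_imp_le less_le_trans\<close>)
qed

lemma hausdorff_measure_eq_SUP:
  "hausdorff_measure \<alpha> E = (SUP \<delta>\<in>{0<..}. hausdorff_content \<alpha> \<delta> E)"
  unfolding hausdorff_measure_def
  by (rule tendsto_Lim[OF _ hausdorff_content_tendsto]) simp

text \<open>No measurability of the pieces is required.\<close>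

definition hausdorff_sigma_finite :: "real \<Rightarrow> 'a::metric_space set \<Rightarrow> bool" where
  "hausdorff_sigma_finite \<alpha> D \<longleftrightarrow>
     (\<exists>A :: nat \<Rightarrow> 'a set. D = (\<Union>i. A i) \<and> (\<forall>i. hausdorff_measure \<alpha> (A i) < \<infinity>))"

definition gen_avg_lebesgue_point ::
  "('a::metric_space set \<Rightarrow> ennreal) \<Rightarrow> real \<Rightarrow> ('a \<Rightarrow> 'b::metric_space) \<Rightarrow> 'a \<Rightarrow> bool" where
  "gen_avg_lebesgue_point \<mu> q u x \<longleftrightarrow>
     Liminf (at_right (0::real))
       (\<lambda>\<epsilon>. (1 / \<mu> (cball x \<epsilon>) ^ 2) *
          (\<integral>\<^sup>+z\<in>cball x \<epsilon>.
             (\<integral>\<^sup>+v\<in>cball x \<epsilon>. ennreal (dist (u z) (u v) powr q) \<partial>caratheodory_measure \<mu>)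
             \<partial>caratheodory_measure \<mu>)) = 0"

end

theory Submission
  imports Defs
begin

text \<open>
  If \<open>x\<close> is not a general average Lebesgue point, there is \<open>\<kappa> > 0\<close> such that the double average
  over \<open>cball x \<epsilon>\<close> is at least \<open>\<kappa>\<close> for all small \<open>\<epsilon>\<close>. For fixed \<open>\<kappa>\<close>, consider finitely many
  such points with pairwise distances greater than \<open>t = 2 \<epsilon>\<close>. Their \<open>\<epsilon>\<close>-balls are disjoint, and the
  product of such a ball with itself lies in \<open>{(z, v). dist z v \<le> t}\<close>; hence the double integrals
  add up to at most a constant times \<open>t\<^sup>s\<^sup>+\<^sup>r\<^sup>q\<close> by the Besov bound, while each is at least a constant
  times \<open>t\<^sup>2\<^sup>s\<close>. So there are at most \<open>K t\<^sup>r\<^sup>q\<^sup>-\<^sup>s\<close> points, and covering by \<open>t\<close>-balls around a maximal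
  separated family bounds the Hausdorff measure.

  The double integrals are iterated lower integrals, and only their superadditivity is needed. This
  avoids Fubini and the joint measurability of \<open>dist (u z) (u v)\<close>.
\<close>

section \<open>Superadditivity of lower integrals\<close>

text \<open>For an arbitrary integrand, \<open>nn_integral\<close> is the supremum over simple
  functions below it. The sum of a simple minorant of \<open>f\<close> and one of \<open>g\<close>
  is a simple minorant of the sum.\<close>

lemma nn_integral_superadd:
  "nn_integral M f + nn_integral M g \<le> (\<integral>\<^sup>+x. f x + g x \<partial>M)"
proof -
  let ?S = "\<lambda>f. {h. simple_function M h \<and> h \<le> f}"
  have ne: "?S f \<noteq> {}" "?S g \<noteq> {}"
    by (auto simp: le_fun_def intro!: exI[of _ "\<lambda>_. 0"])
  have "nn_integral M f + nn_integral M g = (SUP h\<in>?S f. integral\<^sup>S M h + nn_integral M g)"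
    unfolding nn_integral_def[of M f] using ne(1) by (rule ennreal_SUP_add_left[symmetric])
  also have "\<dots> = (SUP h\<in>?S f. SUP k\<in>?S g. integral\<^sup>S M h + integral\<^sup>S M k)"
    unfolding nn_integral_def[of M g] by (simp only: ennreal_SUP_add_right[OF ne(2)])
  also have "\<dots> \<le> (\<integral>\<^sup>+x. f x + g x \<partial>M)"
  proof (intro SUP_least)
    fix h k assume "h \<in> ?S f" "k \<in> ?S g"
    then have hk: "simple_function M h" "simple_function M k" "h \<le> f" "k \<le> g"
      by auto
    have "integral\<^sup>S M h + integral\<^sup>S M k = (\<integral>\<^sup>+x. h x + k x \<partial>M)"
      using hk by (simp add: nn_integral_eq_simple_integral simple_integral_add)
    also have "\<dots> \<le> (\<integral>\<^sup>+x. f x + g x \<partial>M)"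
      using hk by (intro nn_integral_mono add_mono) (auto simp: le_fun_def)
    finally show "integral\<^sup>S M h + integral\<^sup>S M k \<le> (\<integral>\<^sup>+x. f x + g x \<partial>M)" .
  qed
  finally show ?thesis .
qed

lemma nn_integral_superadd_sum:
  assumes "finite S"
  shows "(\<Sum>i\<in>S. nn_integral M (f i)) \<le> (\<integral>\<^sup>+x. (\<Sum>i\<in>S. f i x) \<partial>M)"
  using assms
proof (induction S)
  case (insert i S)
  then have "(\<Sum>j\<in>insert i S. nn_integral M (f j))
      \<le> nn_integral M (f i) + (\<integral>\<^sup>+x. (\<Sum>j\<in>S. f j x) \<partial>M)"
    by (simp add: add_left_mono)
  also have "\<dots> \<le> (\<integral>\<^sup>+x. f i x + (\<Sum>j\<in>S. f j x) \<partial>M)"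
    by (rule nn_integral_superadd)
  finally show ?case using insert by simp
qed simp

text \<open>Multiplying a simple minorant of \<open>f\<close> by \<open>c\<close> gives a simple
  minorant of the scaled integrand; this also covers \<open>c = top\<close>.\<close>

lemma nn_integral_cmult_ge:
  "c * nn_integral M f \<le> (\<integral>\<^sup>+x. c * f x \<partial>M)"
proof -
  have "c * nn_integral M f = (SUP h\<in>{h. simple_function M h \<and> h \<le> f}. c * integral\<^sup>S M h)"
    by (simp add: nn_integral_def SUP_mult_left_ennreal)
  also have "\<dots> \<le> (\<integral>\<^sup>+x. c * f x \<partial>M)"
  proof (intro SUP_least)
    fix h assume "h \<in> {h. simple_function M h \<and> h \<le> f}"
    then have h: "simple_function M h" "h \<le> f" by auto
    then have "c * integral\<^sup>S M h = (\<integral>\<^sup>+x. c * h x \<partial>M)"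
      by (simp add: nn_integral_eq_simple_integral simple_integral_mult)
    also have "\<dots> \<le> (\<integral>\<^sup>+x. c * f x \<partial>M)"
      using h by (intro nn_integral_mono mult_left_mono) (auto simp: le_fun_def)
    finally show "c * integral\<^sup>S M h \<le> (\<integral>\<^sup>+x. c * f x \<partial>M)" .
  qed
  finally show ?thesis .
qed

text \<open>The squares \<open>B i \<times> B i\<close> are disjoint and lie in the region where
  \<open>v \<in> E z\<close>. After superadditivity it suffices to compare integrands at a fixed
  \<open>z\<close>, where at most one summand is nonzero.\<close>

lemma sum_nn_integral_disjoint_squares_le:
  assumes "finite S" "disjoint_family_on B S"
    and sub: "\<And>i z. i \<in> S \<Longrightarrow> z \<in> B i \<Longrightarrow> B i \<subseteq> E z"
  shows "(\<Sum>i\<in>S. \<integral>\<^sup>+z\<in>B i. (\<integral>\<^sup>+v\<in>B i. g z v \<partial>M) \<partial>M) \<le> (\<integral>\<^sup>+z. (\<integral>\<^sup>+v\<in>E z. g z v \<partial>M) \<partial>M)"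
proof -
  have "(\<Sum>i\<in>S. \<integral>\<^sup>+z\<in>B i. (\<integral>\<^sup>+v\<in>B i. g z v \<partial>M) \<partial>M)
      \<le> (\<integral>\<^sup>+z. (\<Sum>i\<in>S. (\<integral>\<^sup>+v\<in>B i. g z v \<partial>M) * indicator (B i) z) \<partial>M)"
    using assms(1) by (rule nn_integral_superadd_sum)
  also have "\<dots> \<le> (\<integral>\<^sup>+z. (\<integral>\<^sup>+v\<in>E z. g z v \<partial>M) \<partial>M)"
  proof (intro nn_integral_mono)
    fix z
    show "(\<Sum>i\<in>S. (\<integral>\<^sup>+v\<in>B i. g z v \<partial>M) * indicator (B i) z) \<le> (\<integral>\<^sup>+v\<in>E z. g z v \<partial>M)"
    proof (cases "\<exists>i\<in>S. z \<in> B i")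
      case True
      then obtain i where i: "i \<in> S" "z \<in> B i" by blast
      have "z \<notin> B j" if "j \<in> S - {i}" for j
        using assms(2) i that by (auto simp: disjoint_family_on_def)
      then have "(\<Sum>j\<in>S. (\<integral>\<^sup>+v\<in>B j. g z v \<partial>M) * indicator (B j) z)
          = (\<integral>\<^sup>+v\<in>B i. g z v \<partial>M) * indicator (B i) z"
        by (subst sum.remove[OF assms(1) i(1)]) (simp add: sum.neutral)
      also have "\<dots> \<le> (\<integral>\<^sup>+v\<in>E z. g z v \<partial>M)"
        using i sub[OF i] by (auto intro!: nn_integral_mono split: split_indicator)
      finally show ?thesis .
    next
      case False
      then show ?thesis by (simp add: sum.neutral)
    qed
  qed
  finally show ?thesis .
qed

section \<open>Extended powers and diameters\<close>

lemma ennreal_rpow_mono: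
  assumes "x \<le> y" "0 \<le> a"
  shows "ennreal_rpow x a \<le> ennreal_rpow y a"
proof (cases "y = \<infinity>")
  case False
  then have "y < top" by (simp add: less_top)
  then have "x \<noteq> \<infinity>" "enn2real x \<le> enn2real y"
    using assms by (auto simp: enn2real_mono)
  then show ?thesis
    using assms False by (auto simp: ennreal_rpow_def intro!: ennreal_leI powr_mono2)
qed (auto simp: ennreal_rpow_def)

lemma ennreal_rpow_ennreal:
  assumes "0 < x"
  shows "ennreal_rpow (ennreal x) a = ennreal (x powr a)"
  using assms by (simp add: ennreal_rpow_def)

text \<open>Serves to undo the outer power in \<open>besov_norm\<close>, with
  \<open>a = 1 / q\<close>.\<close>

lemma ennreal_rpow_le_ennrealD:
  assumes "ennreal_rpow x a \<le> ennreal n" "0 < a" "0 \<le> n"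
  shows "x \<le> ennreal (n powr (1 / a))"
proof (cases x)
  case (real y)
  then have "y powr a \<le> n" using assms by (simp add: ennreal_rpow_def)
  then have "(y powr a) powr (1 / a) \<le> n powr (1 / a)"
    using assms by (intro powr_mono2) auto
  then show ?thesis using real assms by (simp add: powr_powr ennreal_leI)
next
  case top
  then show ?thesis using assms by (simp add: ennreal_rpow_def top_unique)
qed

lemma ediam_cball_le: "ediam (cball x t) \<le> ennreal (2 * t)"
  unfolding ediam_def
proof (intro SUP_least, clarify)
  fix y z assume "y \<in> cball x t" "z \<in> cball x t"
  then have "dist y z \<le> 2 * t"
    using dist_triangle[of y z x] by (auto simp: dist_commute)
  then show "ennreal (dist y z) \<le> ennreal (2 * t)" by (rule ennreal_leI)
qed

lemma ediam_UNIV_eq_0D: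
  assumes "ediam (UNIV :: 'a::metric_space set) = 0"
  shows "(x::'a) = y"
proof -
  have "ennreal (dist x y) \<le> ediam (UNIV :: 'a set)"
    unfolding ediam_def by (rule SUP_upper2[of "(x, y)"]) auto
  then show ?thesis using assms by simp
qed

section \<open>Separated sets and Hausdorff measure\<close>

text \<open>Since cardinalities are bounded, some separated subset has the largest one. A point of
  \<open>A\<close> outside its \<open>t\<close>-balls could be added to it, a contradiction.\<close>

lemma maximal_separated_set:
  fixes A :: "'a::metric_space set"
  assumes "0 \<le> t"
    and bdd: "\<And>S. finite S \<Longrightarrow> S \<subseteq> A \<Longrightarrow> pairwise (\<lambda>x y. t < dist x y) S \<Longrightarrow> card S \<le> n"
  obtains S where "finite S" "S \<subseteq> A" "pairwise (\<lambda>x y. t < dist x y) S" "A \<subseteq> (\<Union>x\<in>S. cball x t)"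
proof -
  let ?P = "\<lambda>S. finite S \<and> S \<subseteq> A \<and> pairwise (\<lambda>x y. t < dist x y) S"
  have "?P {}" by simp
  then obtain S where S: "?P S" and max: "\<And>T. ?P T \<Longrightarrow> card T \<le> card S"
    using ex_has_greatest_nat[of ?P "{}" card "Suc n"] bdd by (auto simp: less_Suc_eq_le)
  have "A \<subseteq> (\<Union>x\<in>S. cball x t)"
  proof (rule subsetI, rule ccontr)
    fix a assume a: "a \<in> A" "a \<notin> (\<Union>x\<in>S. cball x t)"
    then have far: "t < dist x a" if "x \<in> S" for x
      using that by (simp add: not_le)
    have "a \<notin> S" using far[of a] assms(1) by auto
    then show False
      using max[of "insert a S"] S a far by (auto simp: pairwise_insert dist_commute)
  qed
  then show ?thesis using that S by blast
qed

lemma hausdorff_content_finite_cover_le: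
  fixes A :: "'a::metric_space set"
  assumes "finite S" "A \<subseteq> (\<Union>x\<in>S. cball x t)" "0 < t" "0 \<le> \<alpha>"
  shows "hausdorff_content \<alpha> (2 * t) A \<le> ennreal (card S * (2 * t) powr \<alpha>)"
proof -
  obtain f where f: "bij_betw f {..<card S} S"
    using ex_bij_betw_nat_finite[OF assms(1)] by (auto simp: atLeast0LessThan)
  \<comment> \<open>A cover has to be a sequence, so the balls are followed by empty sets. These
    have gauge 0 even for \<open>\<alpha> = 0\<close>.\<close>
  define B where "B i = (if i < card S then cball (f i) t else {})" for i
  have "A \<subseteq> (\<Union>i. B i)"
  proof
    fix a assume "a \<in> A"
    then obtain x where "x \<in> S" "a \<in> cball x t" using assms(2) by auto
    moreover then obtain i where "i < card S" "f i = x"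
      using f by (metis bij_betw_iff_bijections lessThan_iff)
    ultimately show "a \<in> (\<Union>i. B i)" by (auto simp: B_def intro!: exI[of _ i])
  qed
  moreover have "ediam (B i) \<le> ennreal (2 * t)" for i
    using ediam_cball_le[of "f i" t] by (auto simp: B_def ediam_def)
  ultimately have "hausdorff_content \<alpha> (2 * t) A \<le> (\<Sum>i. hausdorff_gauge \<alpha> (B i))"
    unfolding hausdorff_content_def by (intro INF_lower) auto
  also have "\<dots> = (\<Sum>i<card S. hausdorff_gauge \<alpha> (B i))"
    by (intro suminf_finite) (auto simp: B_def hausdorff_gauge_def)
  also have "\<dots> \<le> (\<Sum>i<card S. ennreal ((2 * t) powr \<alpha>))"
  proof (intro sum_mono)
    fix i assume "i \<in> {..<card S}"
    then show "hausdorff_gauge \<alpha> (B i) \<le> ennreal ((2 * t) powr \<alpha>)"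
      using ennreal_rpow_mono[OF ediam_cball_le[of "f i" t] assms(4)] assms(3)
      by (simp add: hausdorff_gauge_def B_def ennreal_rpow_ennreal)
  qed
  also have "\<dots> = ennreal (card S * (2 * t) powr \<alpha>)"
    by (simp add: ennreal_mult ennreal_of_nat_eq_real_of_nat)
  finally show ?thesis .
qed

text \<open>The bound \<open>K\<close> limits the size of a maximal \<open>t\<close>-separated
  subset of \<open>A\<close>, whose \<open>t\<close>-balls cover \<open>A\<close>. They have
  diameter at most \<open>2 * t\<close>, whence the factor \<open>2 powr \<alpha>\<close>.\<close>

lemma hausdorff_measure_le_of_packing:
  fixes A :: "'a::metric_space set"
  assumes "0 \<le> \<alpha>" "0 < t0"
    and pack: "\<And>t S. 0 < t \<Longrightarrow> t < t0 \<Longrightarrow> finite S \<Longrightarrow> S \<subseteq> A \<Longrightarrow>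
      pairwise (\<lambda>x y. t < dist x y) S \<Longrightarrow> card S * t powr \<alpha> \<le> K"
  shows "hausdorff_measure \<alpha> A \<le> ennreal (2 powr \<alpha> * K)"
  unfolding hausdorff_measure_eq_SUP
proof (rule SUP_least)
  fix \<delta> :: real assume "\<delta> \<in> {0<..}"
  \<comment> \<open>The first entry makes the \<open>t\<close>-balls admissible for
    \<open>\<delta>\<close>, the second gives \<open>t < t0\<close> strictly.\<close>
  define t where "t = min (\<delta> / 2) (t0 / 2)"
  have t: "0 < t" "t < t0" "2 * t \<le> \<delta>"
    using \<open>\<delta> \<in> {0<..}\<close> assms(2) by (auto simp: t_def)
  have "card S \<le> nat \<lfloor>K / t powr \<alpha>\<rfloor>"
    if "finite S" "S \<subseteq> A" "pairwise (\<lambda>x y. t < dist x y) S" for S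
    using pack[OF t(1,2) that] t(1) by (simp add: le_nat_floor pos_le_divide_eq)
  then obtain S where S: "finite S" "S \<subseteq> A" "pairwise (\<lambda>x y. t < dist x y) S"
      and cover: "A \<subseteq> (\<Union>x\<in>S. cball x t)"
    using maximal_separated_set[of t A] t(1) by (metis less_imp_le)
  have "hausdorff_content \<alpha> \<delta> A \<le> hausdorff_content \<alpha> (2 * t) A"
    using t(3) by (rule hausdorff_content_antimono)
  also have "\<dots> \<le> ennreal (card S * (2 * t) powr \<alpha>)"
    using S(1) cover t(1) assms(1) by (rule hausdorff_content_finite_cover_le)
  also have "\<dots> \<le> ennreal (2 powr \<alpha> * K)"
    using mult_left_mono[OF pack[OF t(1,2) S], of "2 powr \<alpha>"] t(1)
    by (intro ennreal_leI) (simp add: powr_mult ac_simps)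
  finally show "hausdorff_content \<alpha> \<delta> A \<le> ennreal (2 powr \<alpha> * K)" .
qed

section \<open>Packing bounds from the Besov norm\<close>

text \<open>The supremum in the norm makes one constant, the \<open>q\<close>-th power of the norm,
  valid at every scale \<open>t\<close>.\<close>

lemma besov_norm_finite_integral_bound:
  assumes "besov_norm \<mu> r q u < \<infinity>" "0 < q"
  obtains M where "0 \<le> M"
    "\<And>t. 0 < t \<Longrightarrow>
      (\<integral>\<^sup>+x. (1 / \<mu> (cball x t)) *
         (\<integral>\<^sup>+z\<in>cball x t. ennreal (dist (u x) (u z) powr q / t powr (r * q))
            \<partial>caratheodory_measure \<mu>) \<partial>caratheodory_measure \<mu>) \<le> ennreal M"
proof -
  obtain n where n: "0 \<le> n" "besov_norm \<mu> r q u = ennreal n"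
    using assms(1) by (cases "besov_norm \<mu> r q u") auto
  show ?thesis
  proof (rule that)
    show "0 \<le> n powr q" by simp
    fix t :: real assume t: "0 < t"
    let ?J = "\<integral>\<^sup>+x. (1 / \<mu> (cball x t)) *
         (\<integral>\<^sup>+z\<in>cball x t. ennreal (dist (u x) (u z) powr q / t powr (r * q))
            \<partial>caratheodory_measure \<mu>) \<partial>caratheodory_measure \<mu>"
    have "ennreal_rpow ?J (1 / q) \<le> ennreal n"
      unfolding n(2)[symmetric] besov_norm_def by (rule SUP_upper) (use t in auto)
    from ennreal_rpow_le_ennrealD[OF this] show "?J \<le> ennreal (n powr q)"
      using assms(2) n(1) by simp
  qed
qed

text \<open>In \<open>ennreal\<close>, \<open>1 / 0\<close> is \<open>top\<close>, so the case
  \<open>x = 0\<close> is harmless.\<close>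

lemma ennreal_inverse_le_one_divide:
  assumes "x \<le> ennreal m" "0 < m"
  shows "ennreal (1 / m) \<le> 1 / x"
proof (cases "x = 0")
  case False
  then obtain y where y: "x = ennreal y" "0 < y" "y \<le> m"
    using assms by (cases x) (auto simp: top_unique)
  then have "1 / x = ennreal (1 / y)"
    by (simp flip: divide_ennreal ennreal_1)
  then show ?thesis using y by (simp add: frac_le ennreal_leI)
qed simp

text \<open>The half-radius balls around \<open>t\<close>-separated points are disjoint, so the
  double integrals add up inside the Besov integral at scale \<open>t\<close>. Bounding ball
  measures by \<open>m\<close> turns its weights into a constant.\<close>

lemma sum_double_integrals_le:
  fixes \<mu> :: "'a::metric_space set \<Rightarrow> ennreal" and u :: "'a \<Rightarrow> 'b::metric_space"
  defines "N \<equiv> caratheodory_measure \<mu>"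
  assumes "0 < t" "0 < m"
    and ball: "\<And>x. \<mu> (cball x t) \<le> ennreal m"
    and J: "(\<integral>\<^sup>+x. (1 / \<mu> (cball x t)) *
         (\<integral>\<^sup>+z\<in>cball x t. ennreal (dist (u x) (u z) powr q / t powr (r * q)) \<partial>N) \<partial>N) \<le> ennreal M"
    and S: "finite S" "pairwise (\<lambda>x y. t < dist x y) S"
  shows "ennreal (1 / (m * t powr (r * q))) *
    (\<Sum>x\<in>S. \<integral>\<^sup>+z\<in>cball x (t/2). (\<integral>\<^sup>+v\<in>cball x (t/2). ennreal (dist (u z) (u v) powr q) \<partial>N) \<partial>N)
      \<le> ennreal M"
proof -
  let ?g = "\<lambda>z v. ennreal (dist (u z) (u v) powr q)"
  let ?a = "ennreal (1 / m)" and ?b = "ennreal (1 / t powr (r * q))"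
  have disj: "disjoint_family_on (\<lambda>x. cball x (t/2)) S"
    unfolding disjoint_family_on_def
  proof (intro ballI impI, rule ccontr)
    fix x y assume xy: "x \<in> S" "y \<in> S" "x \<noteq> y" and "cball x (t/2) \<inter> cball y (t/2) \<noteq> {}"
    then obtain z where "dist x z \<le> t/2" "dist y z \<le> t/2" by auto
    moreover have "t < dist x y" using S(2) xy by (simp add: pairwise_def)
    ultimately show False using dist_triangle2[of x y z] by simp
  qed
  \<comment> \<open>Any two points of a ball of radius \<open>t/2\<close> are at distance at most
    \<open>t\<close>, so its square fits into the Besov region.\<close>
  have sub: "cball x (t/2) \<subseteq> cball z t" if "z \<in> cball x (t/2)" for x z :: 'a
  proof
    fix v assume "v \<in> cball x (t/2)"
    then show "v \<in> cball z t"
      using that dist_triangle[of z v x] by (auto simp: dist_commute)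
  qed
  have "(\<Sum>x\<in>S. \<integral>\<^sup>+z\<in>cball x (t/2). (\<integral>\<^sup>+v\<in>cball x (t/2). ?g z v \<partial>N) \<partial>N)
      \<le> (\<integral>\<^sup>+z. (\<integral>\<^sup>+v\<in>cball z t. ?g z v \<partial>N) \<partial>N)"
    by (rule sum_nn_integral_disjoint_squares_le[OF S(1) disj sub])
  \<comment> \<open>The constants move inward by inequalities valid for lower integrals:
    \<open>?a * ?b\<close> through the outer integral, then \<open>?b\<close> through the inner one,
    while \<open>?a\<close> is replaced by the larger weight.\<close>
  then have "?a * ?b * (\<Sum>x\<in>S. \<integral>\<^sup>+z\<in>cball x (t/2). (\<integral>\<^sup>+v\<in>cball x (t/2). ?g z v \<partial>N) \<partial>N)
      \<le> ?a * ?b * (\<integral>\<^sup>+z. (\<integral>\<^sup>+v\<in>cball z t. ?g z v \<partial>N) \<partial>N)"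
    by (rule mult_left_mono) simp
  also have "\<dots> \<le> (\<integral>\<^sup>+z. ?a * ?b * (\<integral>\<^sup>+v\<in>cball z t. ?g z v \<partial>N) \<partial>N)"
    by (rule nn_integral_cmult_ge)
  also have "\<dots> \<le> (\<integral>\<^sup>+z. (1 / \<mu> (cball z t)) *
         (\<integral>\<^sup>+v\<in>cball z t. ennreal (dist (u z) (u v) powr q / t powr (r * q)) \<partial>N) \<partial>N)"
  proof (rule nn_integral_mono)
    fix z
    have a: "?a \<le> 1 / \<mu> (cball z t)"
      using ball[of z] assms(3) by (rule ennreal_inverse_le_one_divide)
    have "?b * (\<integral>\<^sup>+v\<in>cball z t. ?g z v \<partial>N) \<le> (\<integral>\<^sup>+v. ?b * (?g z v * indicator (cball z t) v) \<partial>N)"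
      by (rule nn_integral_cmult_ge)
    also have "\<dots> = (\<integral>\<^sup>+v\<in>cball z t. ennreal (dist (u z) (u v) powr q / t powr (r * q)) \<partial>N)"
      by (intro nn_integral_cong)
        (auto split: split_indicator simp: ennreal_mult[symmetric])
    finally have b: "?b * (\<integral>\<^sup>+v\<in>cball z t. ?g z v \<partial>N)
        \<le> (\<integral>\<^sup>+v\<in>cball z t. ennreal (dist (u z) (u v) powr q / t powr (r * q)) \<partial>N)" .
    show "?a * ?b * (\<integral>\<^sup>+v\<in>cball z t. ?g z v \<partial>N) \<le> (1 / \<mu> (cball z t)) *
         (\<integral>\<^sup>+v\<in>cball z t. ennreal (dist (u z) (u v) powr q / t powr (r * q)) \<partial>N)"
      unfolding mult.assoc by (intro mult_mono[OF a b]) auto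
  qed
  also note J
  also have "?a * ?b = ennreal (1 / (m * t powr (r * q)))"
    using assms(3) by (simp add: ennreal_mult[symmetric])
  finally show ?thesis .
qed

text \<open>Clears the denominator of an average: \<open>m\<close> is finite and, because of
  \<open>l\<close>, nonzero, so \<open>m ^ 2\<close> cancels and can then be lowered to
  \<open>l ^ 2\<close>.\<close>

lemma ennreal_le_of_le_average:
  assumes "ennreal \<kappa> \<le> (1 / m ^ 2) * I" "ennreal l \<le> m" "0 < l" "0 < \<kappa>" "m < \<infinity>"
  shows "ennreal (\<kappa> * l ^ 2) \<le> I"
proof (cases m)
  case (real n)
  then have n: "l \<le> n" "0 < n" using assms by (auto simp: ennreal_le_iff2)
  have m2: "m ^ 2 = ennreal (n ^ 2)" using real by (simp add: ennreal_power)
  have inv: "1 / m ^ 2 = ennreal (1 / n ^ 2)"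
    unfolding m2 using n by (simp flip: divide_ennreal ennreal_1)
  have "ennreal (\<kappa> * l ^ 2) \<le> ennreal (n ^ 2 * \<kappa>)"
    using n assms by (intro ennreal_leI) (simp add: mult.commute power_mono)
  also have "\<dots> = ennreal (n ^ 2) * ennreal \<kappa>"
    using assms by (simp add: ennreal_mult)
  also have "\<dots> \<le> ennreal (n ^ 2) * (ennreal (1 / n ^ 2) * I)"
    using assms(1) unfolding inv by (rule mult_left_mono) simp
  also have "\<dots> = I"
    using n by (simp add: mult.assoc[symmetric] ennreal_mult[symmetric])
  finally show ?thesis .
qed (use assms in auto)

text \<open>This is the function whose \<open>Liminf\<close> appears in
  \<open>gen_avg_lebesgue_point\<close>.\<close>

definition double_average ::
  "('a::metric_space set \<Rightarrow> ennreal) \<Rightarrow> real \<Rightarrow> ('a \<Rightarrow> 'b::metric_space) \<Rightarrow> 'a \<Rightarrow> real \<Rightarrow> ennreal" where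
  "double_average \<mu> q u x \<epsilon> = (1 / \<mu> (cball x \<epsilon>) ^ 2) *
     (\<integral>\<^sup>+z\<in>cball x \<epsilon>.
        (\<integral>\<^sup>+v\<in>cball x \<epsilon>. ennreal (dist (u z) (u v) powr q) \<partial>caratheodory_measure \<mu>)
        \<partial>caratheodory_measure \<mu>)"

text \<open>With \<open>\<kappa>\<close> and \<open>t0\<close> uniform over \<open>A\<close>, each
  double integral over a half-radius ball has a common lower bound, while their sum has the Besov
  upper bound. Comparing the two gives the packing estimate.\<close>

lemma hausdorff_measure_large_average_finite:
  fixes \<mu> :: "'a::metric_space set \<Rightarrow> ennreal" and u :: "'a \<Rightarrow> 'b::metric_space"
  assumes "0 < q" "r * q \<le> s" "besov_norm \<mu> r q u < \<infinity>"
    and "0 < c" "0 < C" "0 < t0"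
    and lower: "\<And>x t. 0 < t \<Longrightarrow> t < t0 \<Longrightarrow> ennreal (c * t powr s) \<le> \<mu> (cball x t)"
    and upper: "\<And>x t. 0 < t \<Longrightarrow> t < t0 \<Longrightarrow> \<mu> (cball x t) \<le> ennreal (C * t powr s)"
    and "0 < \<kappa>"
    and A: "\<And>x \<epsilon>. x \<in> A \<Longrightarrow> 0 < \<epsilon> \<Longrightarrow> \<epsilon> < t0 \<Longrightarrow> ennreal \<kappa> \<le> double_average \<mu> q u x \<epsilon>"
  shows "hausdorff_measure (s - r * q) A < \<infinity>"
proof -
  obtain M where M: "0 \<le> M"
    "\<And>t. 0 < t \<Longrightarrow>
      (\<integral>\<^sup>+x. (1 / \<mu> (cball x t)) *
         (\<integral>\<^sup>+z\<in>cball x t. ennreal (dist (u x) (u z) powr q / t powr (r * q))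
            \<partial>caratheodory_measure \<mu>) \<partial>caratheodory_measure \<mu>) \<le> ennreal M"
    using besov_norm_finite_integral_bound[OF assms(3,1)] by blast
  \<comment> \<open>Dividing the lower bound \<open>\<kappa> * (c * (t/2) powr s)\<^sup>2\<close> by
    \<open>C * t powr s * t powr (r * q)\<close> leaves \<open>L * t powr (s - r * q)\<close>; the
    factor \<open>4 powr s\<close> comes from squaring the half radius.\<close>
  define L where "L = \<kappa> * c\<^sup>2 / (4 powr s * C)"
  have "0 < L" using assms by (simp add: L_def)
  have "hausdorff_measure (s - r * q) A \<le> ennreal (2 powr (s - r * q) * (M / L))"
  proof (rule hausdorff_measure_le_of_packing)
    show "0 \<le> s - r * q" "0 < t0" using assms by auto
    fix t S
    assume t: "0 < t" "t < t0" and S: "finite S" "S \<subseteq> A" "pairwise (\<lambda>x y. t < dist x y) S"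
    let ?l = "c * (t/2) powr s" and ?m = "C * t powr s"
    let ?I = "\<lambda>x. \<integral>\<^sup>+z\<in>cball x (t/2). (\<integral>\<^sup>+v\<in>cball x (t/2).
      ennreal (dist (u z) (u v) powr q) \<partial>caratheodory_measure \<mu>) \<partial>caratheodory_measure \<mu>"
    have "ennreal (\<kappa> * ?l ^ 2) \<le> ?I x" if "x \<in> S" for x
    proof (rule ennreal_le_of_le_average)
      show "ennreal \<kappa> \<le> (1 / \<mu> (cball x (t/2)) ^ 2) * ?I x"
        using A[of x "t/2"] that S(2) t by (auto simp: double_average_def)
      show "ennreal ?l \<le> \<mu> (cball x (t/2))" using lower t by simp
      have "\<mu> (cball x (t/2)) \<le> ennreal (C * (t/2) powr s)" using upper t by simp
      then show "\<mu> (cball x (t/2)) < \<infinity>" by (simp add: le_less_trans)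
    qed (use assms t in auto)
    then have "(\<Sum>x\<in>S. ennreal (\<kappa> * ?l ^ 2)) \<le> (\<Sum>x\<in>S. ?I x)"
      by (rule sum_mono)
    then have "ennreal (1 / (?m * t powr (r * q))) * (\<Sum>x\<in>S. ennreal (\<kappa> * ?l ^ 2))
        \<le> ennreal (1 / (?m * t powr (r * q))) * (\<Sum>x\<in>S. ?I x)"
      by (rule mult_left_mono) simp
    also have "\<dots> \<le> ennreal M"
      using t assms(5) upper M(2)[OF t(1)] S(1,3) by (intro sum_double_integrals_le) auto
    finally have "1 / (?m * t powr (r * q)) * (card S * (\<kappa> * ?l ^ 2)) \<le> M"
      using M(1) assms by (simp add: ennreal_of_nat_eq_real_of_nat ennreal_mult[symmetric])
    also have "1 / (?m * t powr (r * q)) * (card S * (\<kappa> * ?l ^ 2)) = card S * t powr (s - r * q) * L"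
    proof -
      have "(t/2) powr s * (t/2) powr s = t powr s * t powr s / 4 powr s"
        using t powr_mult[of 2 2 s] by (simp add: powr_divide)
      then have "?l ^ 2 = c\<^sup>2 * (t powr s * t powr s / 4 powr s)"
        by (simp add: power2_eq_square ac_simps)
      then show ?thesis
        using t assms(4,5) by (simp add: L_def powr_diff field_simps power2_eq_square)
    qed
    finally show "card S * t powr (s - r * q) \<le> M / L"
      using \<open>0 < L\<close> by (simp add: pos_le_divide_eq)
  qed
  then show ?thesis by (simp add: le_less_trans)
qed

section \<open>Exhaustion of the exceptional set\<close>

text \<open>A single \<open>\<kappa>\<close> bounds both the average from below and the radii from
  above, so that a sequence of values suffices to exhaust the exceptional points.\<close>

lemma not_gen_avg_lebesgue_pointE:
  assumes "\<not> gen_avg_lebesgue_point \<mu> q u x"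
  obtains \<kappa> where "0 < \<kappa>" "\<And>\<epsilon>. 0 < \<epsilon> \<Longrightarrow> \<epsilon> < \<kappa> \<Longrightarrow> ennreal \<kappa> \<le> double_average \<mu> q u x \<epsilon>"
proof -
  have "0 < Liminf (at_right 0) (double_average \<mu> q u x)"
    using assms by (simp add: gen_avg_lebesgue_point_def double_average_def[abs_def] zero_less_iff_neq_zero)
  \<comment> \<open>The value strictly below the \<open>Liminf\<close> is automatically finite and
    is eventually exceeded.\<close>
  then obtain y where y: "0 < y" "y < Liminf (at_right 0) (double_average \<mu> q u x)"
    using dense by blast
  then obtain b where b: "0 < b" "\<And>\<epsilon>. 0 < \<epsilon> \<Longrightarrow> \<epsilon> < b \<Longrightarrow> y < double_average \<mu> q u x \<epsilon>"
    using less_LiminfD[OF y(2)] by (auto simp: eventually_at_right_field)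
  obtain y' where y': "y = ennreal y'" "0 < y'"
    using y by (cases y) auto
  show ?thesis
  proof (rule that[of "min y' b"])
    fix \<epsilon> assume "0 < \<epsilon>" "\<epsilon> < min y' b"
    then have "ennreal (min y' b) \<le> y" "y < double_average \<mu> q u x \<epsilon>"
      using b y' by (auto intro: ennreal_leI)
    then show "ennreal (min y' b) \<le> double_average \<mu> q u x \<epsilon>" by simp
  qed (use b y' in auto)
qed

theorem theorem1p4:
  fixes \<mu> :: "'a::metric_space set \<Rightarrow> ennreal"
    and u :: "'a \<Rightarrow> 'b::metric_space"
    and s r q :: real
  assumes "0 < s"
    and "ahlfors_regular s \<mu>"
    and "0 \<le> r" and "r \<le> 1"
    and "0 < q"
    and "r * q \<le> s"
    and "u \<in> besov_space \<mu> r q"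
  shows "\<exists>D. hausdorff_sigma_finite (s - r * q) D \<and>
             (\<forall>x. x \<notin> D \<longrightarrow> gen_avg_lebesgue_point \<mu> q u x)"
proof -
  obtain c C where cC: "0 < c" "0 < C"
    and reg: "\<And>x t. 0 < t \<Longrightarrow> ennreal t < ediam (UNIV :: 'a set) \<Longrightarrow>
      ennreal (c * t powr s) \<le> \<mu> (cball x t) \<and> \<mu> (cball x t) \<le> ennreal (C * t powr s)"
    using assms(2) unfolding ahlfors_regular_def by blast
  have norm: "besov_norm \<mu> r q u < \<infinity>"
    using assms(7) by (simp add: besov_space_def)
  \<comment> \<open>The failure is made uniform by taking \<open>1 / Suc k\<close> as both the bound
    and the range of radii; the union over \<open>k\<close> will be \<open>D\<close>.\<close>
  define A where "A k = {x. \<forall>\<epsilon>. 0 < \<epsilon> \<and> \<epsilon> < 1 / Suc k \<longrightarrow>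
    ennreal (1 / Suc k) \<le> double_average \<mu> q u x \<epsilon>}" for k
  have "hausdorff_measure (s - r * q) (A k) < \<infinity>" for k
  \<comment> \<open>In a one-point space no positive radius is below the diameter, so regularity
    gives no information. There all averages vanish.\<close>
  proof (cases "ediam (UNIV :: 'a set) = 0")
    case True
    then have dist_0: "dist (u z) (u v) = 0" for z v using ediam_UNIV_eq_0D[of z v] by simp
    have "double_average \<mu> q u x \<epsilon> = 0" for x \<epsilon>
      by (simp add: double_average_def dist_0)
    then have "A k = {}"
      \<comment> \<open>The witness is half the admissible range of radii, where an average of 0
        violates the bound.\<close>
      by (auto simp: A_def intro!: exI[of _ "1 / (2 * real (Suc k))"] divide_strict_left_mono)
    then show ?thesis
      using hausdorff_measure_le_of_packing[of "s - r * q" 1 "A k" 0] assms(6) by (auto simp: le_less_trans)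
  next
    case False
    then obtain d where d: "0 < d" "ennreal d < ediam (UNIV :: 'a set)"
      by (metis dense ennreal_cases ennreal_less_zero_iff infinity_ennreal_def less_top_ennreal not_less_zero zero_less_iff_neq_zero)
    \<comment> \<open>Radii must stay below the diameter for regularity to apply, and below
      \<open>1 / Suc k\<close> for the bound defining \<open>A k\<close>.\<close>
    define t0 where "t0 = min d (1 / Suc k)"
    have t0: "0 < t0" using d(1) by (simp add: t0_def)
    have small: "ennreal t < ediam (UNIV :: 'a set)" if "t < t0" for t
      using that by (intro le_less_trans[OF ennreal_leI d(2)]) (simp add: t0_def)
    show ?thesis
    proof (rule hausdorff_measure_large_average_finite[OF assms(5,6) norm cC t0])
      show "0 < 1 / real (Suc k)" by simp
      show "ennreal (1 / Suc k) \<le> double_average \<mu> q u x \<epsilon>" if "x \<in> A k" "0 < \<epsilon>" "\<epsilon> < t0" for x \<epsilon>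
        using that by (auto simp: A_def t0_def)
    qed (use reg small in auto)
  qed
  then have "hausdorff_sigma_finite (s - r * q) (\<Union>k. A k)"
    unfolding hausdorff_sigma_finite_def by blast
  moreover have "x \<in> (\<Union>k. A k)" if "\<not> gen_avg_lebesgue_point \<mu> q u x" for x
  proof -
    obtain \<kappa> where \<kappa>: "0 < \<kappa>" "\<And>\<epsilon>. 0 < \<epsilon> \<Longrightarrow> \<epsilon> < \<kappa> \<Longrightarrow> ennreal \<kappa> \<le> double_average \<mu> q u x \<epsilon>"
      using not_gen_avg_lebesgue_pointE[OF \<open>\<not> gen_avg_lebesgue_point \<mu> q u x\<close>] by blast
    obtain k where k: "1 / Suc k < \<kappa>"
      using reals_Archimedean[OF \<kappa>(1)] by (auto simp: inverse_eq_divide)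
    \<comment> \<open>Replacing \<open>\<kappa>\<close> by a smaller number weakens the bound and
      shrinks the range of radii, so the property persists.\<close>
    have "ennreal (1 / Suc k) \<le> double_average \<mu> q u x \<epsilon>" if "0 < \<epsilon>" "\<epsilon> < 1 / Suc k" for \<epsilon>
      using k that by (intro order_trans[OF ennreal_leI \<kappa>(2)]) auto
    then show ?thesis by (auto simp: A_def)
  qed
  ultimately show ?thesis by blast
qed

end
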